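(* Let $Pl_{\Psi}(x)=\{\psi\in\Psi:RB_{\Psi}(\psi\,|\,x)>1\}$ be the plausible region. (i) Among all regions $C$ satisfying $$M(\psi_{*}\in C(X)\,|\,\psi_{*})\geq M(\psi_{*}\in Pl_{\Psi}(X)\,|\,\psi_{*})\quad\text{for every }\psi_{*}\in\Psi,$$ the prior probability that the region $C$ covers a value $\psi_{*}$ generated from the prior, namely $$E_{\Pi_{\Psi}}\left(M(\psi_{*}\in C(X))\right)=\int_{\Psi}M(\psi_{*}\in C(X))\,\Pi_{\Psi}(d\psi_{*}),$$ is minimized by $C=Pl_{\Psi}$. (ii) Consider the prior probability of covering a false value, $$\int_{\Psi}\int_{\Psi\backslash\{\psi_{*}\}}M(\psi_{*}\in C(X)\,|\,\psi)\,\Pi_{\Psi}(d\psi)\,\Pi_{\Psi}(d\psi_{*}).$$ If $\Pi_{\Psi}(\{\psi_{*}\})=0$ for all $\psi_{*}\in\Psi$, then $C=Pl_{\Psi}$ minimizes this quantity among all regions $C$ satisfying $M(\psi_{*}\in C(X)\,|\,\psi_{*})\geq M(\psi_{*}\in Pl_{\Psi}(X)\,|\,\psi_{*})$ for every $\psi_{*}$. Otherwise, $C=Pl_{\Psi}$ minimizes this quantity among all regions $C$ satisfying $M(\psi_{*}\in C(X)\,|\,\psi_{*})=M(\psi_{*}\in Pl_{\Psi}(X)\,|\,\psi_{*})$ for all $\psi_{*}$.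
   Context: Setting. $\{f_{\theta}:\theta\in\Theta\}$ is a statistical model of probability densities for data $x\in\mathcal{X}$ with respect to a common $\sigma$-finite support measure $\mu$ on $\mathcal{X}$, with $f_\theta(x)$ jointly measurable. $\Pi$ is a proper prior (a probability measure) on $\Theta$. $\Psi:\Theta\rightarrow\Psi$ is a measurable map that is onto (the same symbol denotes the map and its range), and $\psi=\Psi(\theta)$ is the quantity of interest. $\Pi_{\Psi}$ is the marginal prior of $\psi$ (singletons, and the diagonal of $\Psi\times\Psi$, are measurable), and $\Pi(\cdot\,|\,\psi)$ is the conditional prior of $\theta$ given $\Psi(\theta)=\psi$, a regular conditional probability. Prior predictives. $m(x)=\int_{\Theta}f_{\theta}(x)\,\Pi(d\theta)$ is the prior predictive density and $M(B)=\int_{B}m(x)\,\mu(dx)$. The conditional prior predictive density given $\psi$ is $m(x\,|\,\psi)=\int_{\Theta}f_{\theta}(x)\,\Pi(d\theta\,|\,\psi)$, and $M(B\,|\,\psi)=\int_{B}m(x\,|\,\psi)\,\mu(dx)$. Thus $M(B)=\int_{\Psi}M(B\,|\,\psi)\,\Pi_{\Psi}(d\psi)$. Relative belief ratio. $RB_{\Psi}(\psi\,|\,x)$ is the ratio of the posterior density to the prior density of $\psi$, which equals $m(x\,|\,\psi)/m(x)$. The conditions $RB_{\Psi}(\psi\,|\,x)\le 1$, $<1$, $\ge 1$, $>1$ mean respectively $m(x\,|\,\psi)\le m(x)$, $<$, $\ge$, $>$. Regions. A region $C$ assigns to each $x\in\mathcal{X}$ a set $C(x)\subset\Psi$ such that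 $\{(x,\psi):\psi\in C(x)\}$ is measurable in $\mathcal{X}\times\Psi$. Here $M(\psi_{*}\in C(X)\,|\,\psi)=M(\{x:\psi_{*}\in C(x)\}\,|\,\psi)$, and similarly for $M(\psi_{*}\in C(X))$. *)

theory Defs
  imports "HOL-Probability.Probability"
begin

(* The parameter space is the space of the prior \<pi>, the sample space that of the support
   measure mu. The measure P only supplies the range of Psi with its sigma-algebra. *)

definition statistical_model ::
  "'t measure \<Rightarrow> 'x measure \<Rightarrow> ('t \<Rightarrow> 'x \<Rightarrow> real) \<Rightarrow> bool" where
  "statistical_model \<pi> mu f \<longleftrightarrow>
     sigma_finite_measure mu \<and>
     (\<lambda>(\<theta>, x). f \<theta> x) \<in> borel_measurable (\<pi> \<Otimes>\<^sub>M mu) \<and>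
     (\<forall>\<theta>\<in>space \<pi>. (\<forall>x\<in>space mu. 0 \<le> f \<theta> x) \<and> (\<integral>\<^sup>+x. ennreal (f \<theta> x) \<partial>mu) = 1)"

definition marginal_prior :: "'t measure \<Rightarrow> 'p measure \<Rightarrow> ('t \<Rightarrow> 'p) \<Rightarrow> 'p measure" where
  "marginal_prior \<pi> P Psi = distr \<pi> P Psi"

definition regular_conditional_probability ::
  "'t measure \<Rightarrow> 'p measure \<Rightarrow> ('t \<Rightarrow> 'p) \<Rightarrow> ('p \<Rightarrow> 't measure) \<Rightarrow> bool" where
  "regular_conditional_probability \<pi> P Psi K \<longleftrightarrow>
     K \<in> P \<rightarrow>\<^sub>M prob_algebra \<pi> \<and>
     (\<forall>A\<in>sets \<pi>. \<forall>B\<in>sets P.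
        emeasure \<pi> (A \<inter> (Psi -` B \<inter> space \<pi>)) =
        (\<integral>\<^sup>+\<psi>\<in>B. emeasure (K \<psi>) A \<partial>marginal_prior \<pi> P Psi))"

definition predictive_density ::
  "('t \<Rightarrow> 'x \<Rightarrow> real) \<Rightarrow> 't measure \<Rightarrow> 'x \<Rightarrow> ennreal" where
  "predictive_density f Q x = (\<integral>\<^sup>+\<theta>. ennreal (f \<theta> x) \<partial>Q)"

(* Q = \<pi> gives the prior predictive M, and Q = K psi gives M( . | psi). *)
definition predictive ::
  "'x measure \<Rightarrow> ('t \<Rightarrow> 'x \<Rightarrow> real) \<Rightarrow> 't measure \<Rightarrow> 'x measure" where
  "predictive mu f Q = density mu (predictive_density f Q)"

definition relative_belief ::
  "('t \<Rightarrow> 'x \<Rightarrow> real) \<Rightarrow> 't measure \<Rightarrow> ('p \<Rightarrow> 't measure) \<Rightarrow> 'p \<Rightarrow> 'x \<Rightarrow> ennreal" where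
  "relative_belief f \<pi> K \<psi> x = predictive_density f (K \<psi>) x / predictive_density f \<pi> x"

definition plausible_region ::
  "'p measure \<Rightarrow> ('t \<Rightarrow> 'x \<Rightarrow> real) \<Rightarrow> 't measure \<Rightarrow> ('p \<Rightarrow> 't measure) \<Rightarrow> 'x \<Rightarrow> 'p set" where
  "plausible_region P f \<pi> K x = {\<psi>\<in>space P. relative_belief f \<pi> K \<psi> x > 1}"

definition region :: "'x measure \<Rightarrow> 'p measure \<Rightarrow> ('x \<Rightarrow> 'p set) \<Rightarrow> bool" where
  "region mu P C \<longleftrightarrow>
     (\<forall>x\<in>space mu. C x \<subseteq> space P) \<and>
     {(x, \<psi>). x \<in> space mu \<and> \<psi> \<in> C x} \<in> sets (mu \<Otimes>\<^sub>M P)"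

definition coverage ::
  "'x measure \<Rightarrow> ('t \<Rightarrow> 'x \<Rightarrow> real) \<Rightarrow> 't measure \<Rightarrow> ('x \<Rightarrow> 'p set) \<Rightarrow> 'p \<Rightarrow> ennreal" where
  "coverage mu f Q C \<psi> = emeasure (predictive mu f Q) {x\<in>space mu. \<psi> \<in> C x}"

definition prior_coverage ::
  "'x measure \<Rightarrow> ('t \<Rightarrow> 'x \<Rightarrow> real) \<Rightarrow> 't measure \<Rightarrow> 'p measure \<Rightarrow> ('t \<Rightarrow> 'p)
     \<Rightarrow> ('x \<Rightarrow> 'p set) \<Rightarrow> ennreal" where
  "prior_coverage mu f \<pi> P Psi C = (\<integral>\<^sup>+\<psi>. coverage mu f \<pi> C \<psi> \<partial>marginal_prior \<pi> P Psi)"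

definition prior_false_coverage ::
  "'x measure \<Rightarrow> ('t \<Rightarrow> 'x \<Rightarrow> real) \<Rightarrow> 't measure \<Rightarrow> 'p measure \<Rightarrow> ('t \<Rightarrow> 'p)
     \<Rightarrow> ('p \<Rightarrow> 't measure) \<Rightarrow> ('x \<Rightarrow> 'p set) \<Rightarrow> ennreal" where
  "prior_false_coverage mu f \<pi> P Psi K C =
     (\<integral>\<^sup>+\<psi>'. (\<integral>\<^sup>+\<psi>\<in>space P - {\<psi>'}. coverage mu f (K \<psi>) C \<psi>' \<partial>marginal_prior \<pi> P Psi)
        \<partial>marginal_prior \<pi> P Psi)"

(* Holds also where the prior predictive density is 0 or infinite, so the conventions of
   ennreal division do not affect the plausible region. *)
lemma relative_belief_gt_1_iff:
  "relative_belief f \<pi> K \<psi> x > 1 \<longleftrightarrow> predictive_density f (K \<psi>) x > predictive_density f \<pi> x"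
proof -
  have "1 < a / b \<longleftrightarrow> b < a" for a b :: ennreal
  proof (cases "b = 0 \<or> b = \<top>")
    case True
    then show ?thesis
      by (cases "a = 0") (auto simp: ennreal_divide_self divide_ennreal_def ennreal_mult_top
          top.not_eq_extremum not_less zero_less_iff_neq_zero)
  next
    case False
    then have b: "b \<noteq> 0" "b \<noteq> \<top>" by auto
    show ?thesis
      using b by (metis divide_less_ennreal ennreal_divide_self ennreal_divide_times
          mult.right_neutral mult_1 linorder_not_less divide_le_posI_ennreal ennreal_times_divide
          le_less_trans less_le not_gr_zero top.not_eq_extremum)
  qed
  then show ?thesis by (simp add: relative_belief_def)
qed

lemma regular_conditional_probability_nn_integral:
  assumes K: "regular_conditional_probability \<pi> P Psi K"
    and Psi: "Psi \<in> \<pi> \<rightarrow>\<^sub>M P" and B: "B \<in> sets P"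
    and g: "g \<in> borel_measurable \<pi>"
  shows "(\<integral>\<^sup>+\<theta>. g \<theta> * indicator B (Psi \<theta>) \<partial>\<pi>) =
         (\<integral>\<^sup>+\<psi>\<in>B. (\<integral>\<^sup>+\<theta>. g \<theta> \<partial>K \<psi>) \<partial>marginal_prior \<pi> P Psi)"
proof -
  have Km: "K \<in> P \<rightarrow>\<^sub>M subprob_algebra \<pi>"
    using K by (auto simp: regular_conditional_probability_def intro: measurable_prob_algebraD)
  let ?D = "marginal_prior \<pi> P Psi"
  have sD: "space ?D = space P" and setsD: "sets ?D = sets P"
    by (simp_all add: marginal_prior_def)
  have setK: "sets (K \<psi>) = sets \<pi>" if "\<psi> \<in> space P" for \<psi>
    using sets_kernel[OF Km that] .
  have KmD: "K \<in> ?D \<rightarrow>\<^sub>M subprob_algebra \<pi>"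
    using Km measurable_cong_sets[OF setsD refl] by blast
  have BD: "B \<in> sets ?D" using B setsD by simp
  have M: "(\<lambda>\<psi>. \<integral>\<^sup>+\<theta>. h \<theta> \<partial>K \<psi>) \<in> borel_measurable ?D"
    if "h \<in> borel_measurable \<pi>" for h :: "_ \<Rightarrow> ennreal"
    using measurable_compose[OF KmD nn_integral_measurable_subprob_algebra[OF that]] .
  have MI: "(\<lambda>\<psi>. (\<integral>\<^sup>+\<theta>. h \<theta> \<partial>K \<psi>) * indicator B \<psi>) \<in> borel_measurable ?D"
    if "h \<in> borel_measurable \<pi>" for h :: "_ \<Rightarrow> ennreal"
    using M[OF that] BD by (intro borel_measurable_times_ennreal) simp_all
  have IP: "(\<lambda>\<theta>. indicator B (Psi \<theta>) :: ennreal) \<in> borel_measurable \<pi>"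
    using Psi B by measurable
  show ?thesis
    using g
  proof (induction rule: borel_measurable_induct)
    case (cong h h')
    have "(\<integral>\<^sup>+\<theta>. h \<theta> * indicator B (Psi \<theta>) \<partial>\<pi>) = (\<integral>\<^sup>+\<theta>. h' \<theta> * indicator B (Psi \<theta>) \<partial>\<pi>)"
      by (rule nn_integral_cong) (simp add: cong)
    moreover have "(\<integral>\<^sup>+\<psi>\<in>B. (\<integral>\<^sup>+\<theta>. h \<theta> \<partial>K \<psi>) \<partial>?D) = (\<integral>\<^sup>+\<psi>\<in>B. (\<integral>\<^sup>+\<theta>. h' \<theta> \<partial>K \<psi>) \<partial>?D)"
      by (intro nn_integral_cong arg_cong2[where f = "(*)"] refl)
        (use cong setK sD in \<open>auto dest!: sets_eq_imp_space_eq\<close>)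
    ultimately show ?case using cong by simp
  next
    case (set A)
    have "(\<integral>\<^sup>+\<theta>. indicator A \<theta> * indicator B (Psi \<theta>) \<partial>\<pi>)
        = (\<integral>\<^sup>+\<theta>. indicator (A \<inter> (Psi -` B \<inter> space \<pi>)) \<theta> \<partial>\<pi>)"
      by (intro nn_integral_cong) (auto split: split_indicator)
    also have "\<dots> = emeasure \<pi> (A \<inter> (Psi -` B \<inter> space \<pi>))"
      using set Psi B by (intro nn_integral_indicator) (auto intro: measurable_sets)
    also have "\<dots> = (\<integral>\<^sup>+\<psi>\<in>B. emeasure (K \<psi>) A \<partial>?D)"
      using K set B by (auto simp: regular_conditional_probability_def)
    also have "\<dots> = (\<integral>\<^sup>+\<psi>\<in>B. (\<integral>\<^sup>+\<theta>. indicator A \<theta> \<partial>K \<psi>) \<partial>?D)"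
      by (intro nn_integral_cong) (use set setK sD in \<open>auto simp: nn_integral_indicator\<close>)
    finally show ?case .
  next
    case (mult u c)
    have "(\<integral>\<^sup>+\<psi>\<in>B. (\<integral>\<^sup>+\<theta>. c * u \<theta> \<partial>K \<psi>) \<partial>?D) = (\<integral>\<^sup>+\<psi>. c * ((\<integral>\<^sup>+\<theta>. u \<theta> \<partial>K \<psi>) * indicator B \<psi>) \<partial>?D)"
      by (intro nn_integral_cong)
        (use mult setK sD in \<open>auto simp: nn_integral_cmult mult.assoc cong: measurable_cong_sets\<close>)
    also have "\<dots> = c * (\<integral>\<^sup>+\<psi>\<in>B. (\<integral>\<^sup>+\<theta>. u \<theta> \<partial>K \<psi>) \<partial>?D)"
      using mult by (intro nn_integral_cmult MI)
    finally show ?case using mult by (simp add: mult.assoc nn_integral_cmult borel_measurable_times_ennreal IP)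
  next
    case (add u v)
    have "(\<integral>\<^sup>+\<psi>\<in>B. (\<integral>\<^sup>+\<theta>. v \<theta> + u \<theta> \<partial>K \<psi>) \<partial>?D) =
      (\<integral>\<^sup>+\<psi>. (\<integral>\<^sup>+\<theta>. v \<theta> \<partial>K \<psi>) * indicator B \<psi> + (\<integral>\<^sup>+\<theta>. u \<theta> \<partial>K \<psi>) * indicator B \<psi> \<partial>?D)"
      by (intro nn_integral_cong)
        (use add setK sD in \<open>auto simp: nn_integral_add distrib_right cong: measurable_cong_sets\<close>)
    also have "\<dots> = (\<integral>\<^sup>+\<psi>\<in>B. (\<integral>\<^sup>+\<theta>. v \<theta> \<partial>K \<psi>) \<partial>?D) + (\<integral>\<^sup>+\<psi>\<in>B. (\<integral>\<^sup>+\<theta>. u \<theta> \<partial>K \<psi>) \<partial>?D)"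
      using add by (intro nn_integral_add MI)
    finally show ?case using add by (simp add: distrib_right nn_integral_add borel_measurable_times_ennreal IP)
  next
    case (seq U)
    have inc: "incseq (\<lambda>i \<theta>. U i \<theta> * indicator B (Psi \<theta>))"
      using seq by (auto simp: incseq_def le_fun_def intro!: mult_right_mono)
    have inc': "incseq (\<lambda>i \<psi>. (\<integral>\<^sup>+\<theta>. U i \<theta> \<partial>K \<psi>) * indicator B \<psi>)"
      using seq by (auto simp: incseq_def le_fun_def intro!: mult_right_mono nn_integral_mono)
    have "(\<integral>\<^sup>+\<theta>. (SUP i. U i) \<theta> * indicator B (Psi \<theta>) \<partial>\<pi>)
        = (\<integral>\<^sup>+\<theta>. (SUP i. U i \<theta> * indicator B (Psi \<theta>)) \<partial>\<pi>)"
      by (simp add: SUP_mult_right_ennreal image_comp)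
    also have "\<dots> = (SUP i. \<integral>\<^sup>+\<theta>. U i \<theta> * indicator B (Psi \<theta>) \<partial>\<pi>)"
      using seq IP by (intro nn_integral_monotone_convergence_SUP inc borel_measurable_times_ennreal) simp_all
    also have "\<dots> = (SUP i. \<integral>\<^sup>+\<psi>\<in>B. (\<integral>\<^sup>+\<theta>. U i \<theta> \<partial>K \<psi>) \<partial>?D)"
      using seq by simp
    also have "\<dots> = (\<integral>\<^sup>+\<psi>. (SUP i. (\<integral>\<^sup>+\<theta>. U i \<theta> \<partial>K \<psi>) * indicator B \<psi>) \<partial>?D)"
      using seq by (intro nn_integral_monotone_convergence_SUP[symmetric] inc' MI)
    also have "\<dots> = (\<integral>\<^sup>+\<psi>\<in>B. (\<integral>\<^sup>+\<theta>. (SUP i. U i) \<theta> \<partial>K \<psi>) \<partial>?D)"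
    proof (intro nn_integral_cong)
      fix \<psi> assume p: "\<psi> \<in> space ?D"
      have "(\<integral>\<^sup>+\<theta>. (SUP i. U i) \<theta> \<partial>K \<psi>) = (SUP i. \<integral>\<^sup>+\<theta>. U i \<theta> \<partial>K \<psi>)"
        unfolding SUP_apply using seq setK p sD
        by (intro nn_integral_monotone_convergence_SUP) (auto cong: measurable_cong_sets)
      then show "(SUP i. (\<integral>\<^sup>+\<theta>. U i \<theta> \<partial>K \<psi>) * indicator B \<psi>) =
          (\<integral>\<^sup>+\<theta>. (SUP i. U i) \<theta> \<partial>K \<psi>) * indicator B \<psi>"
        by (simp add: SUP_mult_right_ennreal)
    qed
    finally show ?case .
  qed
qed

(* Justifies relative_belief: it is a version of the density of the posterior of psi
   with respect to its prior. Where the prior predictive density is 0 or infinite, the left-hand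
   side need not be a probability measure, but the identity still holds. *)
lemma relative_belief_is_posterior_density:
  assumes model: "statistical_model \<pi> mu f"
    and K: "regular_conditional_probability \<pi> P Psi K"
    and Psi: "Psi \<in> \<pi> \<rightarrow>\<^sub>M P" and x: "x \<in> space mu"
  shows "distr (density \<pi> (\<lambda>\<theta>. ennreal (f \<theta> x) / predictive_density f \<pi> x)) P Psi =
         density (marginal_prior \<pi> P Psi) (\<lambda>\<psi>. relative_belief f \<pi> K \<psi> x)"
    (is "?L = ?R")
proof (rule measure_eqI)
  show "sets ?L = sets ?R" by (simp add: marginal_prior_def)
next
  fix B assume "B \<in> sets ?L"
  then have B: "B \<in> sets P" by simp
  let ?m = "predictive_density f \<pi> x"
  let ?D = "marginal_prior \<pi> P Psi"
  have f2: "(\<lambda>(\<theta>, x). f \<theta> x) \<in> borel_measurable (\<pi> \<Otimes>\<^sub>M mu)"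
    using model by (simp add: statistical_model_def)
  have fm0: "(\<lambda>\<theta>. f \<theta> x) \<in> borel_measurable \<pi>"
    using measurable_compose[OF measurable_Pair2'[OF x] f2] by simp
  have fm[measurable]: "(\<lambda>\<theta>. ennreal (f \<theta> x)) \<in> borel_measurable \<pi>"
    using fm0 by measurable
  have Km: "K \<in> P \<rightarrow>\<^sub>M subprob_algebra \<pi>"
    using K by (auto simp: regular_conditional_probability_def intro: measurable_prob_algebraD)
  have KD: "K \<in> ?D \<rightarrow>\<^sub>M subprob_algebra \<pi>"
    using Km by (simp add: marginal_prior_def)
  have setK: "sets (K \<psi>) = sets \<pi>" if "\<psi> \<in> space ?D" for \<psi>
    using sets_kernel[OF KD that] .
  have rm: "(\<lambda>\<psi>. relative_belief f \<pi> K \<psi> x) \<in> borel_measurable ?D"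
    unfolding relative_belief_def predictive_density_def
    using measurable_compose[OF KD nn_integral_measurable_subprob_algebra[OF fm]] by measurable
  have "emeasure ?L B = emeasure (density \<pi> (\<lambda>\<theta>. ennreal (f \<theta> x) / ?m)) (Psi -` B \<inter> space \<pi>)"
    using Psi B by (subst emeasure_distr) auto
  also have "\<dots> = (\<integral>\<^sup>+\<theta>. ennreal (f \<theta> x) / ?m * indicator (Psi -` B \<inter> space \<pi>) \<theta> \<partial>\<pi>)"
    using Psi B by (intro emeasure_density) (auto intro: measurable_sets)
  also have "\<dots> = (\<integral>\<^sup>+\<theta>. ennreal (f \<theta> x) / ?m * indicator B (Psi \<theta>) \<partial>\<pi>)"
    by (intro nn_integral_cong) (auto split: split_indicator)
  also have "\<dots> = (\<integral>\<^sup>+\<psi>\<in>B. (\<integral>\<^sup>+\<theta>. ennreal (f \<theta> x) / ?m \<partial>K \<psi>) \<partial>?D)"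
    by (intro regular_conditional_probability_nn_integral K Psi B) measurable
  also have "\<dots> = (\<integral>\<^sup>+\<psi>\<in>B. relative_belief f \<pi> K \<psi> x \<partial>?D)"
  proof (intro nn_integral_cong arg_cong2[where f = "(*)"] refl)
    fix \<psi> assume "\<psi> \<in> space ?D"
    then have "(\<lambda>\<theta>. ennreal (f \<theta> x)) \<in> borel_measurable (K \<psi>)"
      using fm setK measurable_cong_sets by blast
    then show "(\<integral>\<^sup>+\<theta>. ennreal (f \<theta> x) / ?m \<partial>K \<psi>) = relative_belief f \<pi> K \<psi> x"
      by (simp add: relative_belief_def predictive_density_def nn_integral_divide)
  qed
  also have "\<dots> = emeasure ?R B"
    using rm B by (intro emeasure_density[symmetric]) (simp_all add: marginal_prior_def)
  finally show "emeasure ?L B = emeasure ?R B" .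
qed

end

theory Submission
  imports Defs
begin

text \<open>
  For a fixed value \<open>\<psi>'\<close>, the section of the plausible region is the Neyman-Pearson test region
  \<open>{x. m(x | \<psi>') > m(x)}\<close>, so no region with at least its coverage under \<open>m(\<sqdot> | \<psi>')\<close> can
  have smaller coverage under \<open>m\<close>. Integrating over \<open>\<psi>'\<close> gives the first part. For the second,
  disintegrating \<open>M\<close> along \<open>\<psi>\<close> shows that the inner integral of the false coverage falls short of
  \<open>M(\<psi>' \<in> C(X))\<close> exactly by the atom term \<open>\<Pi>({\<psi>'}) M(\<psi>' \<in> C(X) | \<psi>')\<close>, which vanishes in the
  atomless case and does not depend on \<open>C\<close> when the coverages are prescribed.
\<close>

section \<open>Neyman-Pearson comparison of two densities\<close>

text \<open>\<open>A\<close> and \<open>B\<close> differ only off \<open>A \<inter> B\<close>. There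
  \<open>h < g\<close> on the side of \<open>B\<close> and \<open>g \<le> h\<close> on the side of
  \<open>A\<close>, which gives the chain h(B - A) \<le> g(B - A) \<le> g(A - B) \<le> h(A - B). The
  \<open>h\<close>-mass of the intersection is only added back at the end, so it may be
  infinite.\<close>

lemma neyman_pearson_emeasure:
  assumes g: "g \<in> borel_measurable M" and h: "h \<in> borel_measurable M"
    and A: "A \<in> sets M" and B: "B \<in> sets M"
    and Bdef: "\<And>x. x \<in> space M \<Longrightarrow> x \<in> B \<longleftrightarrow> h x < g x"
    and fin: "emeasure (density M g) (A \<inter> B) \<noteq> \<infinity>"
    and le: "emeasure (density M g) B \<le> emeasure (density M g) A"
  shows "emeasure (density M h) B \<le> emeasure (density M h) A"
proof -
  have split: "emeasure (density M k) X =
      emeasure (density M k) (A \<inter> B) + emeasure (density M k) (X - (A \<inter> B))"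
    if "X \<in> sets M" "A \<inter> B \<subseteq> X" for X and k :: "'a \<Rightarrow> ennreal"
    using that A B by (subst plus_emeasure) (auto intro!: arg_cong2[where f = emeasure])
  have diff: "A - A \<inter> B \<in> sets M" "B - A \<inter> B \<in> sets M"
    using A B by auto
  have "emeasure (density M h) (B - A \<inter> B) \<le> emeasure (density M g) (B - A \<inter> B)"
    using g h diff Bdef
    by (auto simp: emeasure_density intro!: nn_integral_mono split: split_indicator dest: less_imp_le)
  \<comment> \<open>The \<open>g\<close>-mass of \<open>A \<inter> B\<close> is cancelled from both
    sides of \<open>le\<close>, which is sound in \<open>ennreal\<close> by
    \<open>fin\<close>.\<close>
  also have "\<dots> \<le> emeasure (density M g) (A - A \<inter> B)"
    using le fin split[of A g] split[of B g] A B by simp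
  also have "\<dots> \<le> emeasure (density M h) (A - A \<inter> B)"
    using g h diff Bdef
    by (auto simp: emeasure_density not_less intro!: nn_integral_mono split: split_indicator)
  finally show ?thesis
    using split[of A h] split[of B h] A B by (simp add: add_left_mono)
qed

section \<open>Predictive measures and their disintegration along \<psi>\<close>

lemma predictive_density_measurable:
  assumes model: "statistical_model \<pi> mu f" and Q: "prob_space Q" "sets Q = sets \<pi>"
  shows "predictive_density f Q \<in> borel_measurable mu"
proof -
  interpret Q: prob_space Q by fact
  have "(\<lambda>(\<theta>, x). f \<theta> x) \<in> borel_measurable (Q \<Otimes>\<^sub>M mu)"
    using model Q(2) by (simp add: statistical_model_def cong: measurable_cong_sets sets_pair_measure_cong)
  then have "(\<lambda>(x, \<theta>). f \<theta> x) \<in> borel_measurable (mu \<Otimes>\<^sub>M Q)"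
    by (subst measurable_pair_swap_iff) (simp add: case_prod_beta')
  then show ?thesis
    unfolding predictive_density_def[abs_def] by measurable
qed

text \<open>Tonelli. With \<theta> outermost, the integrand is the probability of \<open>B\<close>
  under \<theta>, which does not involve \<open>Q\<close>; the prior and each conditional prior thus
  integrate the same function of \<theta>.\<close>

lemma emeasure_predictive:
  assumes model: "statistical_model \<pi> mu f" and Q: "prob_space Q" "sets Q = sets \<pi>"
    and B: "B \<in> sets mu"
  shows "emeasure (predictive mu f Q) B = (\<integral>\<^sup>+\<theta>. (\<integral>\<^sup>+x\<in>B. ennreal (f \<theta> x) \<partial>mu) \<partial>Q)"
proof -
  interpret Q: prob_space Q by fact
  interpret mu: sigma_finite_measure mu using model by (simp add: statistical_model_def)
  interpret pair_sigma_finite Q mu ..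
  have f[measurable]: "(\<lambda>(\<theta>, x). f \<theta> x) \<in> borel_measurable (Q \<Otimes>\<^sub>M mu)"
    using model Q(2) by (simp add: statistical_model_def cong: measurable_cong_sets sets_pair_measure_cong)
  note [measurable] = B predictive_density_measurable[OF model Q]
  have sec: "(\<lambda>\<theta>. ennreal (f \<theta> x)) \<in> borel_measurable Q" if "x \<in> space mu" for x
    using measurable_compose[OF measurable_Pair2'[OF that] f] by simp
  have "emeasure (predictive mu f Q) B = (\<integral>\<^sup>+x\<in>B. (\<integral>\<^sup>+\<theta>. ennreal (f \<theta> x) \<partial>Q) \<partial>mu)"
    using B predictive_density_measurable[OF model Q]
    by (simp add: predictive_def emeasure_density predictive_density_def)
  also have "\<dots> = (\<integral>\<^sup>+x. (\<integral>\<^sup>+\<theta>. ennreal (f \<theta> x) * indicator B x \<partial>Q) \<partial>mu)"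
    by (intro nn_integral_cong) (simp add: nn_integral_multc sec)
  also have "\<dots> = (\<integral>\<^sup>+\<theta>. (\<integral>\<^sup>+x\<in>B. ennreal (f \<theta> x) \<partial>mu) \<partial>Q)"
    by (rule Fubini') measurable
  finally show ?thesis .
qed

text \<open>Supplies the finiteness behind the cancellations in \<open>ennreal\<close>
  below.\<close>

lemma emeasure_predictive_le_1:
  assumes model: "statistical_model \<pi> mu f" and Q: "prob_space Q" "sets Q = sets \<pi>"
  shows "emeasure (predictive mu f Q) B \<le> 1"
proof -
  interpret Q: prob_space Q by fact
  have "emeasure (predictive mu f Q) B \<le> emeasure (predictive mu f Q) (space mu)"
    using emeasure_space[of "predictive mu f Q"] by (simp add: predictive_def)
  also have "\<dots> = (\<integral>\<^sup>+\<theta>. (\<integral>\<^sup>+x\<in>space mu. ennreal (f \<theta> x) \<partial>mu) \<partial>Q)"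
    by (rule emeasure_predictive[OF model Q]) simp
  also have "\<dots> = (\<integral>\<^sup>+\<theta>. 1 \<partial>Q)"
  proof (rule nn_integral_cong)
    fix \<theta> assume "\<theta> \<in> space Q"
    then have "\<theta> \<in> space \<pi>" using sets_eq_imp_space_eq[OF Q(2)] by simp
    then have "(\<integral>\<^sup>+x. ennreal (f \<theta> x) \<partial>mu) = 1"
      using model by (simp add: statistical_model_def)
    moreover have "(\<integral>\<^sup>+x\<in>space mu. ennreal (f \<theta> x) \<partial>mu) = (\<integral>\<^sup>+x. ennreal (f \<theta> x) \<partial>mu)"
      by (intro nn_integral_cong) simp
    ultimately show "(\<integral>\<^sup>+x\<in>space mu. ennreal (f \<theta> x) \<partial>mu) = 1" by simp
  qed
  finally show ?thesis by (simp add: Q.emeasure_space_1)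
qed

lemma regular_conditional_probability_kernel:
  assumes K: "regular_conditional_probability \<pi> P Psi K"
  shows "K \<in> P \<rightarrow>\<^sub>M subprob_algebra \<pi>"
    and "\<psi> \<in> space P \<Longrightarrow> prob_space (K \<psi>)"
    and "\<psi> \<in> space P \<Longrightarrow> sets (K \<psi>) = sets \<pi>"
proof -
  have Km: "K \<in> P \<rightarrow>\<^sub>M prob_algebra \<pi>"
    using K by (simp add: regular_conditional_probability_def)
  then show "K \<in> P \<rightarrow>\<^sub>M subprob_algebra \<pi>" by (rule measurable_prob_algebraD)
  show "prob_space (K \<psi>)" "sets (K \<psi>) = sets \<pi>" if "\<psi> \<in> space P"
    using measurable_space[OF Km that] by (auto simp: space_prob_algebra)
qed

text \<open>By \<open>emeasure_predictive\<close>, both sides integrate \<open>?g\<close>, once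
  against the prior and once against the conditional priors, so the disintegration of the prior
  carries over to M.\<close>

lemma emeasure_predictive_disintegration:
  assumes prior: "prob_space \<pi>" and model: "statistical_model \<pi> mu f"
    and Psi: "Psi \<in> \<pi> \<rightarrow>\<^sub>M P" and K: "regular_conditional_probability \<pi> P Psi K"
    and B: "B \<in> sets mu"
  shows "emeasure (predictive mu f \<pi>) B =
      (\<integral>\<^sup>+\<psi>. emeasure (predictive mu f (K \<psi>)) B \<partial>marginal_prior \<pi> P Psi)"
    and "(\<lambda>\<psi>. emeasure (predictive mu f (K \<psi>)) B) \<in> borel_measurable P"
proof -
  interpret mu: sigma_finite_measure mu using model by (simp add: statistical_model_def)
  let ?D = "marginal_prior \<pi> P Psi"
  let ?g = "\<lambda>\<theta>. \<integral>\<^sup>+x\<in>B. ennreal (f \<theta> x) \<partial>mu"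
  note kernel = regular_conditional_probability_kernel[OF K]
  have spD: "space ?D = space P" by (simp add: marginal_prior_def)
  have [measurable]: "(\<lambda>(\<theta>, x). f \<theta> x) \<in> borel_measurable (\<pi> \<Otimes>\<^sub>M mu)"
    using model by (simp add: statistical_model_def)
  note [measurable] = B
  have g: "?g \<in> borel_measurable \<pi>" by measurable
  have Kg: "emeasure (predictive mu f (K \<psi>)) B = (\<integral>\<^sup>+\<theta>. ?g \<theta> \<partial>K \<psi>)" if "\<psi> \<in> space P" for \<psi>
    using emeasure_predictive[OF model kernel(2,3)[OF that] B] .
  \<comment> \<open>The indicator is constantly 1; it brings the integral into the form that the
    disintegration rule for \<open>K\<close> expects.\<close>
  have "emeasure (predictive mu f \<pi>) B = (\<integral>\<^sup>+\<theta>. ?g \<theta> * indicator (space P) (Psi \<theta>) \<partial>\<pi>)"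
    unfolding emeasure_predictive[OF model prior refl B]
    by (intro nn_integral_cong) (simp add: measurable_space[OF Psi])
  also have "\<dots> = (\<integral>\<^sup>+\<psi>\<in>space P. (\<integral>\<^sup>+\<theta>. ?g \<theta> \<partial>K \<psi>) \<partial>?D)"
    by (rule regular_conditional_probability_nn_integral[OF K Psi sets.top g])
  also have "\<dots> = (\<integral>\<^sup>+\<psi>. emeasure (predictive mu f (K \<psi>)) B \<partial>?D)"
    by (intro nn_integral_cong) (simp add: spD Kg)
  finally show "emeasure (predictive mu f \<pi>) B = \<dots>" .
  have "(\<lambda>\<psi>. \<integral>\<^sup>+\<theta>. ?g \<theta> \<partial>K \<psi>) \<in> borel_measurable P"
    using measurable_compose[OF kernel(1) nn_integral_measurable_subprob_algebra[OF g]] .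
  then show "(\<lambda>\<psi>. emeasure (predictive mu f (K \<psi>)) B) \<in> borel_measurable P"
    by (rule measurable_cong[THEN iffD1, rotated]) (simp add: Kg)
qed

section \<open>Measurability of regions\<close>

lemma region_section:
  assumes "region mu P C" "\<psi> \<in> space P"
  shows "{x\<in>space mu. \<psi> \<in> C x} \<in> sets mu"
proof -
  have "(\<lambda>x. (x, \<psi>)) -` {(x, \<psi>). x \<in> space mu \<and> \<psi> \<in> C x} \<inter> space mu \<in> sets mu"
    using assms by (intro measurable_sets[OF measurable_Pair2']) (auto simp: region_def)
  also have "(\<lambda>x. (x, \<psi>)) -` {(x, \<psi>). x \<in> space mu \<and> \<psi> \<in> C x} \<inter> space mu = {x\<in>space mu. \<psi> \<in> C x}"
    by auto
  finally show ?thesis .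
qed

text \<open>Makes the plausible region itself a competitor. The point is joint measurability of m(x
  | \<psi>) in both arguments.\<close>

lemma region_plausible_region:
  assumes prior: "prob_space \<pi>" and model: "statistical_model \<pi> mu f"
    and K: "regular_conditional_probability \<pi> P Psi K"
  shows "region mu P (plausible_region P f \<pi> K)"
proof -
  let ?N = "mu \<Otimes>\<^sub>M P"
  have f[measurable]: "(\<lambda>(\<theta>, x). f \<theta> x) \<in> borel_measurable (\<pi> \<Otimes>\<^sub>M mu)"
    using model by (simp add: statistical_model_def)
  note [measurable] = predictive_density_measurable[OF model prior refl]
    regular_conditional_probability_kernel(1)[OF K]
  have "(\<lambda>z. \<integral>\<^sup>+\<theta>. ennreal (f \<theta> (fst z)) \<partial>K (snd z)) \<in> borel_measurable ?N"
  \<comment> \<open>The pair z = (x, \<psi>) is the parameter: \<open>K (snd z)\<close> is the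
    kernel, and the integrand must be jointly measurable in z and \<theta>, which follows from
    \<open>f\<close> by rearranging coordinates.\<close>
  proof (rule nn_integral_measurable_subprob_algebra2[where N = \<pi>])
    have "(\<lambda>z. (snd z, fst (fst z))) \<in> ?N \<Otimes>\<^sub>M \<pi> \<rightarrow>\<^sub>M \<pi> \<Otimes>\<^sub>M mu" by measurable
    from measurable_compose[OF this f]
    show "(\<lambda>(z, \<theta>). ennreal (f \<theta> (fst z))) \<in> borel_measurable (?N \<Otimes>\<^sub>M \<pi>)"
      by (simp add: case_prod_beta')
  qed measurable
  then have [measurable]: "(\<lambda>z. predictive_density f (K (snd z)) (fst z)) \<in> borel_measurable ?N"
    by (simp add: predictive_density_def)
  have "{z\<in>space ?N. predictive_density f \<pi> (fst z) < predictive_density f (K (snd z)) (fst z)} \<in> sets ?N"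
    by measurable
  also have "{z\<in>space ?N. predictive_density f \<pi> (fst z) < predictive_density f (K (snd z)) (fst z)} =
      {(x, \<psi>). x \<in> space mu \<and> \<psi> \<in> plausible_region P f \<pi> K x}"
    by (auto simp: plausible_region_def relative_belief_gt_1_iff space_pair_measure)
  finally show ?thesis
    by (auto simp: region_def plausible_region_def)
qed

section \<open>Comparison of true and false coverages\<close>

lemma coverage_plausible_region_le:
  assumes prior: "prob_space \<pi>" and model: "statistical_model \<pi> mu f"
    and K: "regular_conditional_probability \<pi> P Psi K"
    and C: "region mu P C" and \<psi>: "\<psi> \<in> space P"
    and le: "coverage mu f (K \<psi>) (plausible_region P f \<pi> K) \<psi> \<le> coverage mu f (K \<psi>) C \<psi>"
  shows "coverage mu f \<pi> (plausible_region P f \<pi> K) \<psi> \<le> coverage mu f \<pi> C \<psi>"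
proof -
  note kernel = regular_conditional_probability_kernel(2,3)[OF K \<psi>]
  let ?A = "{x\<in>space mu. \<psi> \<in> C x}" and ?B = "{x\<in>space mu. \<psi> \<in> plausible_region P f \<pi> K x}"
  show ?thesis
    unfolding coverage_def predictive_def
  proof (rule neyman_pearson_emeasure)
    show "predictive_density f (K \<psi>) \<in> borel_measurable mu"
      by (rule predictive_density_measurable[OF model kernel])
    show "predictive_density f \<pi> \<in> borel_measurable mu"
      by (rule predictive_density_measurable[OF model prior refl])
    show "?A \<in> sets mu" "?B \<in> sets mu"
      by (rule region_section[OF C \<psi>], rule region_section[OF region_plausible_region[OF prior model K] \<psi>])
    show "x \<in> ?B \<longleftrightarrow> predictive_density f \<pi> x < predictive_density f (K \<psi>) x"
      if "x \<in> space mu" for x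
      using that \<psi> by (simp add: plausible_region_def relative_belief_gt_1_iff)
    show "emeasure (density mu (predictive_density f (K \<psi>))) (?A \<inter> ?B) \<noteq> \<infinity>"
      using emeasure_predictive_le_1[OF model kernel, of "?A \<inter> ?B"]
      by (auto simp: predictive_def top_unique)
    show "emeasure (density mu (predictive_density f (K \<psi>))) ?B
        \<le> emeasure (density mu (predictive_density f (K \<psi>))) ?A"
      using le by (simp add: coverage_def predictive_def)
  qed
qed

text \<open>The section of \<open>C\<close> at \<psi>' is one fixed event, so M of it disintegrates
  over \<psi>; the integral is then split at \<psi> = \<psi>'.\<close>

lemma coverage_split_atom:
  assumes prior: "prob_space \<pi>" and model: "statistical_model \<pi> mu f"
    and Psi: "Psi \<in> \<pi> \<rightarrow>\<^sub>M P" and K: "regular_conditional_probability \<pi> P Psi K"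
    and C: "region mu P C" and \<psi>': "\<psi>' \<in> space P" "{\<psi>'} \<in> sets P"
  shows "coverage mu f \<pi> C \<psi>' =
      (\<integral>\<^sup>+\<psi>\<in>space P - {\<psi>'}. coverage mu f (K \<psi>) C \<psi>' \<partial>marginal_prior \<pi> P Psi) +
      coverage mu f (K \<psi>') C \<psi>' * emeasure (marginal_prior \<pi> P Psi) {\<psi>'}"
proof -
  let ?D = "marginal_prior \<pi> P Psi"
  let ?c = "\<lambda>\<psi>. coverage mu f (K \<psi>) C \<psi>'"
  note dis = emeasure_predictive_disintegration[OF prior model Psi K region_section[OF C \<psi>'(1)],
      folded coverage_def]
  have D: "space ?D = space P" "sets ?D = sets P" by (simp_all add: marginal_prior_def)
  have [measurable]: "?c \<in> borel_measurable ?D"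
    using dis(2) by (simp add: marginal_prior_def)
  have [measurable]: "{\<psi>'} \<in> sets ?D" "space P - {\<psi>'} \<in> sets ?D"
    using \<psi>' D by (auto simp del: insert_Diff_single)
  have "coverage mu f \<pi> C \<psi>' = (\<integral>\<^sup>+\<psi>. ?c \<psi> \<partial>?D)"
    by (rule dis(1))
  \<comment> \<open>On the singleton, \<open>?c \<psi>\<close> is replaced by the constant
    \<open>?c \<psi>'\<close>, so that it can leave the integral.\<close>
  also have "\<dots> = (\<integral>\<^sup>+\<psi>. ?c \<psi> * indicator (space P - {\<psi>'}) \<psi> + ?c \<psi>' * indicator {\<psi>'} \<psi> \<partial>?D)"
    by (intro nn_integral_cong) (auto simp: D split: split_indicator)
  also have "\<dots> = (\<integral>\<^sup>+\<psi>\<in>space P - {\<psi>'}. ?c \<psi> \<partial>?D) + (\<integral>\<^sup>+\<psi>. ?c \<psi>' * indicator {\<psi>'} \<psi> \<partial>?D)"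
    by (rule nn_integral_add) measurable
  also have "(\<integral>\<^sup>+\<psi>. ?c \<psi>' * indicator {\<psi>'} \<psi> \<partial>?D) = ?c \<psi>' * emeasure ?D {\<psi>'}"
    by (rule nn_integral_cmult_indicator) measurable
  finally show ?thesis .
qed

text \<open>The hypothesis \<open>atom\<close> serves both cases of the second part: either way the
  atom terms of the two regions agree, so the inequality between coverages under M passes to the
  false coverages, pointwise in \<psi>'.\<close>

lemma prior_false_coverage_plausible_region_le:
  assumes prior: "prob_space \<pi>" and model: "statistical_model \<pi> mu f"
    and Psi: "Psi \<in> \<pi> \<rightarrow>\<^sub>M P" and singletons: "\<forall>\<psi>\<in>space P. {\<psi>} \<in> sets P"
    and K: "regular_conditional_probability \<pi> P Psi K" and C: "region mu P C"
    and le: "\<And>\<psi>. \<psi> \<in> space P \<Longrightarrow>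
      coverage mu f (K \<psi>) (plausible_region P f \<pi> K) \<psi> \<le> coverage mu f (K \<psi>) C \<psi>"
    and atom: "\<And>\<psi>. \<psi> \<in> space P \<Longrightarrow> emeasure (marginal_prior \<pi> P Psi) {\<psi>} = 0 \<or>
      coverage mu f (K \<psi>) C \<psi> = coverage mu f (K \<psi>) (plausible_region P f \<pi> K) \<psi>"
  shows "prior_false_coverage mu f \<pi> P Psi K (plausible_region P f \<pi> K)
      \<le> prior_false_coverage mu f \<pi> P Psi K C"
  unfolding prior_false_coverage_def
proof (rule nn_integral_mono)
  fix \<psi>' assume "\<psi>' \<in> space (marginal_prior \<pi> P Psi)"
  then have \<psi>': "\<psi>' \<in> space P" by (simp add: marginal_prior_def)
  let ?Pl = "plausible_region P f \<pi> K"
  let ?D = "marginal_prior \<pi> P Psi"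
  let ?F = "\<lambda>C. \<integral>\<^sup>+\<psi>\<in>space P - {\<psi>'}. coverage mu f (K \<psi>) C \<psi>' \<partial>?D"
  let ?a = "\<lambda>C. coverage mu f (K \<psi>') C \<psi>' * emeasure ?D {\<psi>'}"
  note split = coverage_split_atom[OF prior model Psi K _ \<psi>' bspec[OF singletons \<psi>']]
  have "prob_space ?D"
    unfolding marginal_prior_def by (rule prob_space.prob_space_distr[OF prior Psi])
  then have "emeasure ?D {\<psi>'} \<noteq> \<infinity>"
    by (simp add: finite_measure.emeasure_finite prob_space.finite_measure)
  moreover have "coverage mu f (K \<psi>') C \<psi>' \<noteq> \<infinity>"
    using emeasure_predictive_le_1[OF model regular_conditional_probability_kernel(2,3)[OF K \<psi>']]
    unfolding coverage_def by (metis ennreal_one_less_top infinity_ennreal_def not_less)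
  \<comment> \<open>The atom term is about to be cancelled in \<open>ennreal\<close>, so it must be
    finite; both of its factors are.\<close>
  ultimately have "?a C \<noteq> \<infinity>"
    by (simp add: ennreal_mult_eq_top_iff)
  moreover have "?a ?Pl = ?a C" using atom[OF \<psi>'] by auto
  moreover have "?F ?Pl + ?a ?Pl \<le> ?F C + ?a C"
    using coverage_plausible_region_le[OF prior model K C \<psi>' le[OF \<psi>']]
    by (simp add: split[OF C] split[OF region_plausible_region[OF prior model K]])
  ultimately show "?F ?Pl \<le> ?F C"
    by (simp add: add.commute[of _ "?a C"])
qed

theorem theorem5:
  fixes \<pi> :: "'t measure" and mu :: "'x measure" and P :: "'p measure"
    and f :: "'t \<Rightarrow> 'x \<Rightarrow> real" and Psi :: "'t \<Rightarrow> 'p" and K :: "'p \<Rightarrow> 't measure"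
  assumes prior: "prob_space \<pi>"
    and model: "statistical_model \<pi> mu f"
    and Psi_measurable: "Psi \<in> \<pi> \<rightarrow>\<^sub>M P"
    and Psi_onto: "Psi ` space \<pi> = space P"
    and singletons: "\<forall>\<psi>\<in>space P. {\<psi>} \<in> sets P"
    and diagonal: "{(\<psi>, \<psi>') \<in> space P \<times> space P. \<psi> = \<psi>'} \<in> sets (P \<Otimes>\<^sub>M P)"
    and conditional_prior: "regular_conditional_probability \<pi> P Psi K"
  shows
    "let Pl = plausible_region P f \<pi> K in
       is_arg_min (prior_coverage mu f \<pi> P Psi)
         (\<lambda>C. region mu P C \<and>
              (\<forall>\<psi>\<in>space P. coverage mu f (K \<psi>) C \<psi> \<ge> coverage mu f (K \<psi>) Pl \<psi>)) Pl
     \<and> (if \<forall>\<psi>\<in>space P. emeasure (marginal_prior \<pi> P Psi) {\<psi>} = 0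
        then is_arg_min (prior_false_coverage mu f \<pi> P Psi K)
          (\<lambda>C. region mu P C \<and>
               (\<forall>\<psi>\<in>space P. coverage mu f (K \<psi>) C \<psi> \<ge> coverage mu f (K \<psi>) Pl \<psi>)) Pl
        else is_arg_min (prior_false_coverage mu f \<pi> P Psi K)
          (\<lambda>C. region mu P C \<and>
               (\<forall>\<psi>\<in>space P. coverage mu f (K \<psi>) C \<psi> = coverage mu f (K \<psi>) Pl \<psi>)) Pl)"
proof -
  let ?Pl = "plausible_region P f \<pi> K"
  note Pl = region_plausible_region[OF prior model conditional_prior]
  have cov: "prior_coverage mu f \<pi> P Psi ?Pl \<le> prior_coverage mu f \<pi> P Psi C"
    if "region mu P C" "\<forall>\<psi>\<in>space P. coverage mu f (K \<psi>) ?Pl \<psi> \<le> coverage mu f (K \<psi>) C \<psi>" for C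
    unfolding prior_coverage_def
    using that coverage_plausible_region_le[OF prior model conditional_prior]
    by (intro nn_integral_mono) (simp add: marginal_prior_def)
  \<comment> \<open>The disjunction is stated per \<psi>, so one fact covers both branches of the
    \<open>if\<close>.\<close>
  have false_cov: "prior_false_coverage mu f \<pi> P Psi K ?Pl \<le> prior_false_coverage mu f \<pi> P Psi K C"
    if "region mu P C" "\<forall>\<psi>\<in>space P. coverage mu f (K \<psi>) ?Pl \<psi> \<le> coverage mu f (K \<psi>) C \<psi>"
      "\<forall>\<psi>\<in>space P. emeasure (marginal_prior \<pi> P Psi) {\<psi>} = 0 \<or>
        coverage mu f (K \<psi>) C \<psi> = coverage mu f (K \<psi>) ?Pl \<psi>" for C
    using that prior_false_coverage_plausible_region_le
      [OF prior model Psi_measurable singletons conditional_prior] by blast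
  \<comment> \<open>Since \<open>ennreal\<close> is linearly ordered, having no strictly smaller
    competitor means \<le> against every competitor. In the branch with equal coverages,
    \<open>order_refl\<close> yields the required inequality.\<close>
  show ?thesis
    unfolding Let_def is_arg_min_def
    by (simp add: Pl not_less) (metis cov false_cov order_refl)
qed

end
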